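(* Let $a, b, n$ be real numbers with $a < \frac{2n+1}{4}$, such that all Pochhammer symbols and quotients appearing below are defined. Let $$f(n,b) := \sum_{k=0}^{\infty} \frac{(a)_{k+b}^4}{(n-a+1)_{k+b}^4}\,(n+2k+2b).$$ For integers $j \ge -1$ let $$q_1(j) = -10a^2+8ab+22aj+14an+28a-2b^2-10bj-6bn-12b-13j^2-16jn-32j-5n^2-20n-20,$$ $$q_2(j) = 4a-2j-2n-3,$$ $$s_2(j) = \frac{(-2a+j+n+2)^5\,(2b+3j+n+4)}{(-a+b+2j+n+3)^4},$$ and let $$s_1(n) = \frac{(-2a+n+1)^5}{4(4a-2n-1)(-a+n+1)^4}.$$ Then $$f(n,b) = s_1(n)\sum_{j=-1}^{\infty}\left(-\frac14\right)^{j}\frac{q_1(j)+s_2(j)}{q_2(j)}\cdot\frac{(n-2a+2)_j^5}{\left(n-2a+\frac32\right)_j\,(n-a+2)_j^4}\cdot\frac{(a)_{j+b+1}^4}{(n+j-a+2)_{j+b+1}^4}.$$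
   Context: The Pochhammer symbol is defined by $(x)_k := \frac{\Gamma(x+k)}{\Gamma(x)}$, where $\Gamma$ is the Gamma function and $k$ need not be a nonnegative integer; in particular $(x)_{-1} = \frac{1}{x-1}$. The notation $(x)_k^m$ means $\big((x)_k\big)^m$. *)

theory Defs
  imports "HOL-Analysis.Analysis"
begin

text \<open>
  The library's \<^const>\<open>pochhammer\<close> only takes a natural number as its second argument.
  Here the shift is an arbitrary real number, so the symbol is the Gamma quotient.
\<close>
definition gpoch :: "real \<Rightarrow> real \<Rightarrow> real" where
  "gpoch x k = Gamma (x + k) / Gamma x"

text \<open>
  \<^const>\<open>Gamma\<close> is total and returns 0 at its poles, the nonpositive integers. The quotient
  \<^term>\<open>gpoch x k\<close> is therefore meaningful only when neither argument is a pole, and it is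
  then nonzero as well.
\<close>
definition gpoch_defined :: "real \<Rightarrow> real \<Rightarrow> bool" where
  "gpoch_defined x k \<longleftrightarrow> x + k \<notin> \<int>\<^sub>\<le>\<^sub>0 \<and> x \<notin> \<int>\<^sub>\<le>\<^sub>0"

definition f_term :: "real \<Rightarrow> real \<Rightarrow> real \<Rightarrow> nat \<Rightarrow> real" where
  "f_term a n b k =
     gpoch a (real k + b) ^ 4 / gpoch (n - a + 1) (real k + b) ^ 4 * (n + 2 * real k + 2 * b)"

definition f :: "real \<Rightarrow> real \<Rightarrow> real \<Rightarrow> real" where
  "f a n b = (\<Sum>k. f_term a n b k)"

definition q1 :: "real \<Rightarrow> real \<Rightarrow> real \<Rightarrow> int \<Rightarrow> real" where
  "q1 a b n i = (let j = real_of_int i in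
     - 10 * a ^ 2 + 8 * a * b + 22 * a * j + 14 * a * n + 28 * a - 2 * b ^ 2
     - 10 * b * j - 6 * b * n - 12 * b - 13 * j ^ 2 - 16 * j * n - 32 * j
     - 5 * n ^ 2 - 20 * n - 20)"

definition q2 :: "real \<Rightarrow> real \<Rightarrow> int \<Rightarrow> real" where
  "q2 a n i = (let j = real_of_int i in 4 * a - 2 * j - 2 * n - 3)"

definition s2 :: "real \<Rightarrow> real \<Rightarrow> real \<Rightarrow> int \<Rightarrow> real" where
  "s2 a b n i = (let j = real_of_int i in
     (- 2 * a + j + n + 2) ^ 5 * (2 * b + 3 * j + n + 4) / (- a + b + 2 * j + n + 3) ^ 4)"

definition s1 :: "real \<Rightarrow> real \<Rightarrow> real" where
  "s1 a n = (- 2 * a + n + 1) ^ 5 / (4 * (4 * a - 2 * n - 1) * (- a + n + 1) ^ 4)"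

definition rhs_term :: "real \<Rightarrow> real \<Rightarrow> real \<Rightarrow> int \<Rightarrow> real" where
  "rhs_term a b n i = (let j = real_of_int i in
     (- 1 / 4) powi i
     * ((q1 a b n i + s2 a b n i) / q2 a n i)
     * (gpoch (n - 2 * a + 2) j ^ 5
        / (gpoch (n - 2 * a + 3 / 2) j * gpoch (n - a + 2) j ^ 4))
     * (gpoch a (j + b + 1) ^ 4 / gpoch (n + j - a + 2) (j + b + 1) ^ 4))"

end

theory Submission
  imports Defs "HOL-Real_Asymp.Real_Asymp"
begin

text \<open>
  The identity is a series acceleration by a Wilf--Zeilberger argument. Two relations connect
  the values of \<^const>\<open>f\<close> at neighbouring parameters. Dropping the first summand gives
  \[ f(n,b) = F(n,b) + f(n,b+1), \]
  where $F(n,b) = (a)_b^4\,(n+2b)/(n-a+1)_b^4$. A rational certificate $G$ for the summand gives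
  \[ f(n,b) = G(n,b) + 2 s_1(n)\, f(n+1,b), \]
  since $F(n,b) - 2 s_1(n) F(n+1,b) = G(n,b) - G(n,b+1)$ telescopes along $b, b+1, b+2, \dots$
  (lemmas \<open>summand_certificate\<close> and \<open>f_contiguous\<close>). Both together lead one step along the diagonal:
  \[ f(n,b) = G(n,b) + 2 s_1(n) F(n+1,b) + 2 s_1(n)\, f(n+1,b+1). \]

  Iterating from $(n,b)$ produces, at the point $(n+m,b+m)$, the product
  $\prod_{i<m} 2 s_1(n+i)$ times $G(n+m,b+m) + 2 s_1(n+m) F(n+m+1,b+m)$. This is exactly the term of
  index $j = m-1$ on the right-hand side, times $s_1(n)$ (lemma \<open>rhs_term_eq\<close>): the two summands
  account for $q_1$ and $s_2$.

  Two limits remain. The quotient $(a)_{k+b}/(n-a+1)_{k+b}$ has order $k^{2a-n-1}$, so that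
  $F(n,b+k)$ has order $k^{8a-4n-3}$ and $G(n,b+k)$ has order $k^{8a-4n-2}$; the hypothesis
  $a < (2n+1)/4$ is precisely what makes the first summable and the second a null sequence. The
  remainder after $m$ steps, $f(n+m,b+m) \prod_{i<m} 2 s_1(n+i)$, tends to $0$ because the factors
  $2 s_1(n+i)$ tend to $-1/4$ while $f(n+m,b+m)$ is eventually nonnegative and decreasing in $m$
  (lemmas \<open>f_diagonal_decreasing\<close> and \<open>remainder_tendsto_0\<close>).
\<close>

section \<open>The quotient of shifted factorials in the summand\<close>

definition gpoch_quotient :: "real \<Rightarrow> real \<Rightarrow> real \<Rightarrow> real" where
  "gpoch_quotient a n b = gpoch a b / gpoch (n - a + 1) b"

lemma f_term_gpoch_quotient: "f_term a n b k = gpoch_quotient a n (b + real k) ^ 4 * (n + 2 * (b + real k))"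
  by (simp add: f_term_def gpoch_quotient_def power_divide add.commute algebra_simps)

lemma gpoch_plus1:
  assumes "x + k \<notin> \<int>\<^sub>\<le>\<^sub>0"
  shows "gpoch x (k + 1) = (x + k) * gpoch x k"
  using Gamma_plus1[OF assms] by (simp add: gpoch_def add.assoc)

lemma gpoch_quotient_shift_b:
  assumes "a + b \<notin> \<int>\<^sub>\<le>\<^sub>0" "n - a + 1 + b \<notin> \<int>\<^sub>\<le>\<^sub>0"
  shows "gpoch_quotient a n (b + 1) = gpoch_quotient a n b * ((a + b) / (n - a + 1 + b))"
  using assms by (simp add: gpoch_quotient_def gpoch_plus1 mult_ac)

lemma gpoch_quotient_shift_n:
  assumes "n - a + 1 \<notin> \<int>\<^sub>\<le>\<^sub>0" "n - a + 1 + b \<notin> \<int>\<^sub>\<le>\<^sub>0"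
  shows "gpoch_quotient a (n + 1) b = gpoch_quotient a n b * ((n - a + 1) / (n - a + 1 + b))"
proof -
  have 1: "Gamma (n + 1 - a + 1) = (n - a + 1) * Gamma (n - a + 1)"
    using Gamma_plus1[OF assms(1)] by (simp add: algebra_simps)
  have 2: "Gamma (n + 1 - a + 1 + b) = (n - a + 1 + b) * Gamma (n - a + 1 + b)"
    using Gamma_plus1[OF assms(2)] by (simp add: algebra_simps)
  show ?thesis unfolding gpoch_quotient_def gpoch_def 1 2 by (simp add: mult_ac)
qed

section \<open>The telescoping certificate\<close>

text \<open>
  The function $G$ of the Wilf--Zeilberger pair: a rational multiple of the summand. Its numerator is
  \<^const>\<open>q1\<close> at \<^term>\<open>-1\<close>, the initial index of the accelerated series.
\<close>
definition certificate :: "real \<Rightarrow> real \<Rightarrow> real \<Rightarrow> real" where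
  "certificate a n b = q1 a b n (-1) / (2 * (4 * a - 2 * n - 1)) * gpoch_quotient a n b ^ 4"

text \<open>
  The telescoping relation of \<open>summand_certificate\<close> after division by the common Gamma factors and
  clearing of denominators; the two sides agree as polynomials in \<^term>\<open>a\<close>, \<^term>\<open>b\<close>,
  \<^term>\<open>n\<close>.
\<close>
lemma certificate_polynomial:
  "2 * (4 * a - 2 * n - 1) * (n + 2 * b) * (n - a + 1 + b) ^ 4
     - (- 2 * a + n + 1) ^ 5 * (n + 1 + 2 * b)
   = q1 a b n (-1) * (n - a + 1 + b) ^ 4 - q1 a (b + 1) n (-1) * (a + b) ^ 4"
  unfolding q1_def Let_def by simp algebra

text \<open>
  Restores the denominators in \<open>certificate_polynomial\<close>. In the application \<open>w\<close> is the quotient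
  of Pochhammer symbols, and \<open>w * (y / x)\<close> and \<open>w * (z / x)\<close> are its values after
  \<open>n\<close> and \<open>b\<close> are raised by one.
\<close>
lemma divide_certificate:
  fixes x y d e w :: real
  assumes "x \<noteq> 0" "y \<noteq> 0" "d \<noteq> 0"
    and "2 * d * u * x ^ 4 - e * v = p * x ^ 4 - q * z ^ 4"
  shows "w ^ 4 * u - 2 * (e / (4 * d * y ^ 4)) * ((w * (y / x)) ^ 4 * v)
       = p / (2 * d) * w ^ 4 - q / (2 * d) * (w * (z / x)) ^ 4"
proof -
  have "u - e * v / (2 * d * x ^ 4) = p / (2 * d) - q * z ^ 4 / (2 * d * x ^ 4)"
    using assms by (simp add: divide_simps) (simp add: algebra_simps)
  from arg_cong[OF this, of "\<lambda>t. w ^ 4 * t"] show ?thesis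
    using assms by (simp add: power_mult_distrib power_divide algebra_simps)
qed

lemma summand_certificate:
  assumes "a + b \<notin> \<int>\<^sub>\<le>\<^sub>0" "n - a + 1 \<notin> \<int>\<^sub>\<le>\<^sub>0" "n - a + 1 + b \<notin> \<int>\<^sub>\<le>\<^sub>0"
    and "4 * a - 2 * n - 1 \<noteq> 0"
  shows "gpoch_quotient a n b ^ 4 * (n + 2 * b)
           - 2 * s1 a n * (gpoch_quotient a (n + 1) b ^ 4 * (n + 1 + 2 * b))
         = certificate a n b - certificate a n (b + 1)"
proof -
  have "n - a + 1 + b \<noteq> 0" "n - a + 1 \<noteq> 0" using assms(2,3) by auto
  moreover have "- a + n + 1 = n - a + 1" by simp
  ultimately show ?thesis
    unfolding certificate_def s1_def gpoch_quotient_shift_b[OF assms(1,3)] gpoch_quotient_shift_n[OF assms(2,3)]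
    using divide_certificate[OF _ _ assms(4) certificate_polynomial[of a n b]] by simp
qed

section \<open>Growth of the summand and convergence\<close>

text \<open>
  The factorials in Euler's limit formula for $1/\Gamma$ cancel when it is taken at both \<open>x\<close> and
  \<open>y\<close>. Since \<open>y\<close> is not a pole of $\Gamma$, the denominator $1/\Gamma(y)$ of the limit is nonzero.
\<close>
lemma pochhammer_ratio_asymptotics:
  fixes x y :: real
  assumes "y \<notin> \<int>\<^sub>\<le>\<^sub>0"
  shows "(\<lambda>k. pochhammer x (Suc k) / pochhammer y (Suc k) * real k powr (y - x))
           \<longlonglongrightarrow> rGamma x / rGamma y"
proof -
  have "rGamma y \<noteq> 0" using assms by (simp add: rGamma_eq_zero_iff)
  then have "(\<lambda>k. rGamma_series x k / rGamma_series y k) \<longlonglongrightarrow> rGamma x / rGamma y"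
    by (intro tendsto_divide rGamma_series_LIMSEQ)
  moreover have "\<forall>\<^sub>F k in sequentially. rGamma_series x k / rGamma_series y k
      = pochhammer x (Suc k) / pochhammer y (Suc k) * real k powr (y - x)"
    using eventually_gt_at_top[of 0]
  proof eventually_elim
    case (elim k)
    have "pochhammer y (Suc k) \<noteq> 0" using assms by (auto simp: pochhammer_eq_0_iff)
    with elim show ?case
      by (simp add: rGamma_series_def powr_def left_diff_distrib exp_diff)
  qed
  ultimately show ?thesis by (rule Lim_transform_eventually)
qed

lemma gpoch_quotient_asymptotics:
  assumes "a + b \<notin> \<int>\<^sub>\<le>\<^sub>0" "n - a + 1 + b \<notin> \<int>\<^sub>\<le>\<^sub>0"
  shows "\<exists>C. (\<lambda>k. gpoch_quotient a n (b + real (Suc k)) * real k powr (n + 1 - 2 * a)) \<longlonglongrightarrow> C"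
proof -
  have poch: "Gamma (z + real k) = pochhammer z k * Gamma z" if "z \<notin> \<int>\<^sub>\<le>\<^sub>0" for z :: real and k
    using pochhammer_Gamma[OF that, of k] that by (simp add: Gamma_eq_zero_iff)
  let ?K = "Gamma (a + b) / Gamma a * (Gamma (n - a + 1) / Gamma (n - a + 1 + b))"
  have "gpoch_quotient a n (b + real k)
      = ?K * (pochhammer (a + b) k / pochhammer (n - a + 1 + b) k)" for k
    unfolding gpoch_quotient_def gpoch_def add.assoc[of a b "real k", symmetric]
      add.assoc[of "n - a + 1" b "real k", symmetric] poch[OF assms(1)] poch[OF assms(2)]
    by (simp add: mult_ac)
  then have eq: "gpoch_quotient a n (b + real (Suc k)) * real k powr (n + 1 - 2 * a)
      = ?K * (pochhammer (a + b) (Suc k) / pochhammer (n - a + 1 + b) (Suc k)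
          * real k powr (n - a + 1 + b - (a + b)))" for k
    by (simp add: mult.assoc del: of_nat_Suc pochhammer_Suc)
  show ?thesis unfolding eq
    by (rule exI, rule tendsto_mult_left, rule pochhammer_ratio_asymptotics) (rule assms(2))
qed

text \<open>
  The index starts at 1 because \<^term>\<open>0 powr x\<close> is 0 for every exponent, so no bound of this
  form can hold at 0 in general.
\<close>
lemma gpoch_quotient_power4_bound:
  assumes "a + b \<notin> \<int>\<^sub>\<le>\<^sub>0" "n - a + 1 + b \<notin> \<int>\<^sub>\<le>\<^sub>0"
  shows "\<exists>C\<ge>0. \<forall>k\<ge>1. gpoch_quotient a n (b + real (Suc k)) ^ 4 \<le> C * real k powr (8 * a - 4 * n - 4)"
proof -
  from gpoch_quotient_asymptotics[OF assms]
  have "Bseq (\<lambda>k. gpoch_quotient a n (b + real (Suc k)) * real k powr (n + 1 - 2 * a))"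
    by (auto intro: convergent_imp_Bseq convergentI)
  then obtain K where K: "K > 0"
      "\<And>k. \<bar>gpoch_quotient a n (b + real (Suc k)) * real k powr (n + 1 - 2 * a)\<bar> \<le> K"
    unfolding Bseq_def by auto
  have "gpoch_quotient a n (b + real (Suc k)) ^ 4 \<le> K ^ 4 * real k powr (8 * a - 4 * n - 4)" if "k \<ge> 1" for k
  proof -
    let ?g = "gpoch_quotient a n (b + real (Suc k))"
    have k: "real k powr (n + 1 - 2 * a) * real k powr (2 * a - n - 1) = 1"
      using that by (simp flip: powr_add)
    have k4: "(real k powr (2 * a - n - 1)) ^ 4 = real k powr (8 * a - 4 * n - 4)"
      using that by (simp add: powr_power algebra_simps)
    have "\<bar>?g\<bar> = \<bar>?g * real k powr (n + 1 - 2 * a)\<bar> * real k powr (2 * a - n - 1)"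
      by (simp add: abs_mult mult.assoc k)
    also have "\<dots> \<le> K * real k powr (2 * a - n - 1)"
      by (intro mult_right_mono K) simp
    finally have "\<bar>?g\<bar> ^ 4 \<le> (K * real k powr (2 * a - n - 1)) ^ 4"
      by (intro power_mono) auto
    then show ?thesis by (simp add: power_mult_distrib k4 power_even_abs)
  qed
  then show ?thesis using K(1) by (intro exI[of _ "K ^ 4"]) auto
qed

lemma f_term_summable:
  assumes "a + b \<notin> \<int>\<^sub>\<le>\<^sub>0" "n - a + 1 + b \<notin> \<int>\<^sub>\<le>\<^sub>0" "a < (2 * n + 1) / 4"
  shows "summable (f_term a n b)"
proof -
  obtain C where C: "C \<ge> 0"
      "\<And>k. k \<ge> 1 \<Longrightarrow> gpoch_quotient a n (b + real (Suc k)) ^ 4 \<le> C * real k powr (8 * a - 4 * n - 4)"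
    using gpoch_quotient_power4_bound[OF assms(1,2)] by blast
  define L where "L = \<bar>n\<bar> + 2 * \<bar>b\<bar> + 4"
  have "norm (f_term a n b (Suc k)) \<le> C * L * real k powr (8 * a - 4 * n - 3)" if "k \<ge> 1" for k
  proof -
    have "\<bar>n\<bar> + 2 * \<bar>b\<bar> \<le> (\<bar>n\<bar> + 2 * \<bar>b\<bar>) * real k"
      using that mult_left_mono[of 1 "real k" "\<bar>n\<bar> + 2 * \<bar>b\<bar>"] by simp
    then have lin: "\<bar>n + 2 * (b + real (Suc k))\<bar> \<le> L * real k"
      using that by (simp add: L_def algebra_simps)
    have "norm (f_term a n b (Suc k))
        = gpoch_quotient a n (b + real (Suc k)) ^ 4 * \<bar>n + 2 * (b + real (Suc k))\<bar>"
      unfolding f_term_gpoch_quotient by (simp add: abs_mult)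
    also have "\<dots> \<le> (C * real k powr (8 * a - 4 * n - 4)) * (L * real k)"
      using C that lin by (intro mult_mono) auto
    also have "\<dots> = C * L * (real k powr (8 * a - 4 * n - 4) * real k powr 1)"
      using that by simp
    also have "\<dots> = C * L * real k powr (8 * a - 4 * n - 3)"
      by (subst powr_add[symmetric]) simp
    finally show ?thesis .
  qed
  moreover have "summable (\<lambda>k. C * L * real k powr (8 * a - 4 * n - 3))"
    using assms(3) by (intro summable_mult) (simp add: summable_real_powr_iff)
  ultimately have "summable (\<lambda>k. f_term a n b (Suc k))"
    by (rule summable_comparison_test'[rotated])
  then show ?thesis by (simp add: summable_Suc_iff)
qed

lemma certificate_tendsto_0:
  assumes "a + b \<notin> \<int>\<^sub>\<le>\<^sub>0" "n - a + 1 + b \<notin> \<int>\<^sub>\<le>\<^sub>0" "a < (2 * n + 1) / 4"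
  shows "(\<lambda>k. certificate a n (b + real k)) \<longlonglongrightarrow> 0"
proof -
  obtain C where C: "C \<ge> 0"
      "\<And>k. k \<ge> 1 \<Longrightarrow> gpoch_quotient a n (b + real (Suc k)) ^ 4 \<le> C * real k powr (8 * a - 4 * n - 4)"
    using gpoch_quotient_power4_bound[OF assms(1,2)] by blast
  \<comment> \<open>The numerator at \<open>b + 1 + k\<close> is the quadratic polynomial \<open>A + B * k - 2 * k\<^sup>2\<close>.\<close>
  define A where "A = q1 a (b + 1) n (-1)"
  define B where "B = 8 * a - 4 * (b + 1) - 6 * n - 2"
  have q: "q1 a (b + real (Suc k)) n (-1) = A + B * real k - 2 * real k ^ 2" for k
    by (simp add: q1_def A_def B_def power2_eq_square algebra_simps)
  define L where "L = \<bar>A\<bar> + \<bar>B\<bar> + 2"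
  define E where "E = \<bar>2 * (4 * a - 2 * n - 1)\<bar>"
  have bound: "norm (certificate a n (b + real (Suc k))) \<le> L * C / E * real k powr (8 * a - 4 * n - 2)"
    if "k \<ge> 1" for k
  proof -
    have k2: "real k \<le> real k ^ 2" "1 \<le> real k ^ 2"
      using that by (simp_all add: power2_eq_square one_le_power[of "real k" 2, unfolded power2_eq_square])
    have "\<bar>A + B * real k - 2 * real k ^ 2\<bar> \<le> \<bar>A\<bar> + \<bar>B\<bar> * real k + 2 * real k ^ 2"
      using abs_triangle_ineq[of A "B * real k"]
        abs_triangle_ineq4[of "A + B * real k" "2 * real k ^ 2"] by (simp add: abs_mult)
    also have "\<dots> \<le> L * real k ^ 2"
      using mult_left_mono[OF k2(1), of "\<bar>B\<bar>"] mult_left_mono[OF k2(2), of "\<bar>A\<bar>"]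
      by (simp add: L_def algebra_simps)
    finally have q1b: "\<bar>q1 a (b + real (Suc k)) n (-1)\<bar> \<le> L * real k ^ 2" by (simp only: q)
    have "norm (certificate a n (b + real (Suc k)))
        = \<bar>q1 a (b + real (Suc k)) n (-1)\<bar> * gpoch_quotient a n (b + real (Suc k)) ^ 4 / E"
      unfolding certificate_def E_def by (simp add: abs_mult)
    also have "\<dots> \<le> (L * real k ^ 2) * (C * real k powr (8 * a - 4 * n - 4)) / E"
      using C that q1b by (intro divide_right_mono mult_mono) (auto simp: E_def L_def)
    also have "\<dots> = L * C / E * (real k powr 2 * real k powr (8 * a - 4 * n - 4))"
      using that by (simp add: powr_numeral)
    also have "\<dots> = L * C / E * real k powr (8 * a - 4 * n - 2)"
      by (subst powr_add[symmetric]) simp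
    finally show ?thesis .
  qed
  have "(\<lambda>k. real k powr (8 * a - 4 * n - 2)) \<longlonglongrightarrow> 0"
    using assms(3) by (intro tendsto_neg_powr filterlim_real_sequentially) simp
  then have lim: "(\<lambda>k. L * C / E * real k powr (8 * a - 4 * n - 2)) \<longlonglongrightarrow> 0"
    by (rule tendsto_mult_right_zero)
  have "(\<lambda>k. certificate a n (b + real (Suc k))) \<longlonglongrightarrow> 0"
    using bound by (intro Lim_null_comparison[OF _ lim] eventually_sequentiallyI[of 1]) auto
  then show ?thesis by (rule LIMSEQ_imp_Suc)
qed

lemma plus_nat_not_nonpos:
  fixes x :: real
  assumes "x \<notin> \<int>\<^sub>\<le>\<^sub>0"
  shows "x + real k \<notin> \<int>\<^sub>\<le>\<^sub>0"
  using assms nonpos_Ints_diff_Nats[of "x + real k" "real k"] by auto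

section \<open>Contiguous relations\<close>

text \<open>
  Summation of \<open>summand_certificate\<close> over \<open>b, b + 1, b + 2, \<dots>\<close>: the right-hand sides
  telescope to the first certificate because the certificates tend to 0.
\<close>
lemma f_contiguous:
  assumes "a + b \<notin> \<int>\<^sub>\<le>\<^sub>0" "n - a + 1 \<notin> \<int>\<^sub>\<le>\<^sub>0" "n - a + 1 + b \<notin> \<int>\<^sub>\<le>\<^sub>0"
    and "a < (2 * n + 1) / 4"
  shows "f a n b = certificate a n b + 2 * s1 a n * f a (n + 1) b"
proof -
  have nz: "n + 1 - a + 1 + b \<notin> \<int>\<^sub>\<le>\<^sub>0"
    using plus_nat_not_nonpos[OF assms(3), of 1] by (simp add: algebra_simps)
  have "f_term a n b k - 2 * s1 a n * f_term a (n + 1) b k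
      = certificate a n (b + real k) - certificate a n (b + real (Suc k))" for k
    using summand_certificate[of a "b + real k" n] assms
      plus_nat_not_nonpos[OF assms(1), of k] plus_nat_not_nonpos[OF assms(3), of k]
    by (simp add: f_term_gpoch_quotient add_ac)
  moreover have "(\<lambda>k. certificate a n (b + real k) - certificate a n (b + real (Suc k))) sums certificate a n b"
    using telescope_sums'[OF certificate_tendsto_0[OF assms(1,3,4)]] by simp
  ultimately have "(\<lambda>k. f_term a n b k - 2 * s1 a n * f_term a (n + 1) b k) sums certificate a n b"
    by simp
  moreover have "(\<lambda>k. f_term a n b k - 2 * s1 a n * f_term a (n + 1) b k)
      sums (f a n b - 2 * s1 a n * f a (n + 1) b)"
    unfolding f_def using assms nz
    by (intro sums_diff sums_mult summable_sums f_term_summable) auto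
  ultimately show ?thesis using sums_unique2 by fastforce
qed

lemma f_split_first:
  assumes "summable (f_term a n b)"
  shows "f a n b = gpoch_quotient a n b ^ 4 * (n + 2 * b) + f a n (b + 1)"
proof -
  have "f_term a n b (Suc k) = f_term a n (b + 1) k" for k
    by (simp add: f_term_gpoch_quotient add_ac)
  moreover have "f_term a n b 0 = gpoch_quotient a n b ^ 4 * (n + 2 * b)" by (simp add: f_term_gpoch_quotient)
  ultimately show ?thesis
    using suminf_split_head[OF assms] by (simp add: f_def)
qed

section \<open>Iteration along the diagonal\<close>

definition step_product :: "real \<Rightarrow> real \<Rightarrow> nat \<Rightarrow> real" where
  "step_product a n m = (\<Prod>i<m. 2 * s1 a (n + real i))"

definition remainder :: "real \<Rightarrow> real \<Rightarrow> real \<Rightarrow> nat \<Rightarrow> real" where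
  "remainder a b n m = step_product a n m * f a (n + real m) (b + real m)"

lemma gpoch_minus1:
  assumes "x \<notin> \<int>\<^sub>\<le>\<^sub>0"
  shows "gpoch (x + 1) (- 1) = 1 / x"
  using Gamma_plus1[OF assms] assms by (simp add: gpoch_def Gamma_eq_zero_iff)

text \<open>
  Identifies the product accumulated by the iteration with the Pochhammer symbols of the
  right-hand side. The factor $1/2$ is the value at the initial index $-1$, where
  $(x+1)_{-1} = 1/x$ makes the coefficient the reciprocal of $2 s_1(n)$.
\<close>
lemma step_product_gpoch:
  assumes "a < (2 * n + 1) / 4" "n - a + 1 \<notin> \<int>\<^sub>\<le>\<^sub>0"
  shows "s1 a n * ((- 1 / 4) powi (int m - 1)
      * (gpoch (n - 2 * a + 2) (real m - 1) ^ 5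
         / (gpoch (n - 2 * a + 3 / 2) (real m - 1) * gpoch (n - a + 2) (real m - 1) ^ 4)))
    = step_product a n m / 2"
proof (induction m)
  case 0
  have pos: "n - 2 * a + 1 / 2 > 0" using assms(1) by simp
  then have "n - 2 * a + 1 / 2 \<notin> \<int>\<^sub>\<le>\<^sub>0" "n - 2 * a + 1 \<notin> \<int>\<^sub>\<le>\<^sub>0" by auto
  then have minus1: "gpoch (n - 2 * a + 3 / 2) (- 1) = 1 / (n - 2 * a + 1 / 2)"
    "gpoch (n - 2 * a + 2) (- 1) = 1 / (n - 2 * a + 1)"
    "gpoch (n - a + 2) (- 1) = 1 / (n - a + 1)"
    using gpoch_minus1[of "n - 2 * a + 1 / 2"] gpoch_minus1[of "n - 2 * a + 1"]
      gpoch_minus1[OF assms(2)] by (simp_all add: add.assoc)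
  have s1: "s1 a n = (n - 2 * a + 1) ^ 5 / (4 * (- 2 * (n - 2 * a + 1 / 2)) * (n - a + 1) ^ 4)"
    by (simp add: s1_def algebra_simps)
  have empty: "(- 1 / 4 :: real) powi (int 0 - 1) = - 4" "step_product a n 0 = 1"
    "real 0 - 1 = - 1"
    by (simp_all add: step_product_def power_int_minus)
  have cancel: "E ^ 5 / (4 * (- 2 * D) * Y ^ 4)
      * (- 4 * ((1 / E) ^ 5 / (1 / D * (1 / Y) ^ 4))) = 1 / 2"
    if "E \<noteq> 0" "D \<noteq> 0" "Y \<noteq> 0" for E D Y :: real
    using that by (simp add: power_one_over)
  show ?case
    unfolding empty minus1 s1 using assms(2) pos by (intro cancel) auto
next
  case (Suc m)
  have nz: "n - 2 * a + 2 + (real m - 1) \<notin> \<int>\<^sub>\<le>\<^sub>0" "n - 2 * a + 3 / 2 + (real m - 1) \<notin> \<int>\<^sub>\<le>\<^sub>0"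
    using assms(1) by auto
  have nz': "n - a + 2 + (real m - 1) \<notin> \<int>\<^sub>\<le>\<^sub>0"
    using plus_nat_not_nonpos[OF assms(2), of m] by (simp add: algebra_simps)
  have pw: "(- 1 / 4 :: real) powi (int (Suc m) - 1) = - 1 / 4 * (- 1 / 4) powi (int m - 1)"
    using power_int_add_1'[of "- 1 / 4 :: real" "int m - 1"] by simp
  have step: "2 * s1 a (n + real m) = - 1 / 4 * ((n - 2 * a + 2 + (real m - 1)) ^ 5
      / ((n - 2 * a + 3 / 2 + (real m - 1)) * (n - a + 2 + (real m - 1)) ^ 4))"
  proof -
    have args: "n - 2 * a + 2 + (real m - 1) = - 2 * a + (n + real m) + 1"
      "n - a + 2 + (real m - 1) = - a + (n + real m) + 1"
      "n - 2 * a + 3 / 2 + (real m - 1) = - (4 * a - 2 * (n + real m) - 1) / 2" by simp_all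
    have "2 * (E / (4 * d * Y)) = - 1 / 4 * (E / (- d / 2 * Y))" for E d Y :: real
      by (simp add: field_simps)
    then show ?thesis unfolding s1_def args .
  qed
  have shift: "real (Suc m) - 1 = (real m - 1) + 1" by simp
  have "step_product a n (Suc m) / 2 = 2 * s1 a (n + real m) * (step_product a n m / 2)"
    by (simp add: step_product_def)
  then show ?case
    unfolding Suc.IH[symmetric] step pw shift gpoch_plus1[OF nz(1)] gpoch_plus1[OF nz(2)]
      gpoch_plus1[OF nz']
    by (simp add: power_mult_distrib)
qed

text \<open>
  Each term of the right-hand side is the contribution of one diagonal step. With
  \<open>N = n + m\<close> and \<open>B = b + m\<close> the polynomials of index \<open>m - 1\<close> are those of index
  \<open>-1\<close> at the parameters \<open>N\<close>, \<open>B\<close>; \<^const>\<open>q1\<close> comes from the certificate and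
  \<^const>\<open>s2\<close> from the first summand of the series at \<open>N + 1\<close>.
\<close>
lemma rhs_term_eq:
  assumes "a < (2 * n + 1) / 4" "n - a + 1 \<notin> \<int>\<^sub>\<le>\<^sub>0"
    and "n + real m - a + 1 + (b + real m) \<notin> \<int>\<^sub>\<le>\<^sub>0"
  shows "s1 a n * rhs_term a b n (int m - 1)
    = step_product a n m * (certificate a (n + real m) (b + real m)
        + 2 * s1 a (n + real m)
          * (gpoch_quotient a (n + real m + 1) (b + real m) ^ 4
             * (n + real m + 1 + 2 * (b + real m))))"
proof -
  define N B where "N = n + real m" and "B = b + real m"
  have y: "N - a + 1 \<notin> \<int>\<^sub>\<le>\<^sub>0"
    using plus_nat_not_nonpos[OF assms(2), of m] by (simp add: N_def algebra_simps)
  have x: "N - a + 1 + B \<notin> \<int>\<^sub>\<le>\<^sub>0" using assms(3) by (simp add: N_def B_def)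
  have x0: "N - a + 1 + B \<noteq> 0" and y0: "N - a + 1 \<noteq> 0" using x y by auto
  have d0: "4 * a - 2 * N - 1 \<noteq> 0" using assms(1) by (simp add: N_def)
  have q1: "q1 a b n (int m - 1) = q1 a B N (-1)"
    unfolding q1_def Let_def N_def B_def by simp algebra
  have q2: "q2 a n (int m - 1) = 4 * a - 2 * N - 1"
    by (simp add: q2_def N_def)
  have s2: "s2 a b n (int m - 1) = (- 2 * a + N + 1) ^ 5 * (N + 1 + 2 * B) / (N - a + 1 + B) ^ 4"
  proof -
    have "- 2 * a + (real m - 1) + n + 2 = - 2 * a + N + 1"
      "2 * b + 3 * (real m - 1) + n + 4 = N + 1 + 2 * B"
      "- a + b + 2 * (real m - 1) + n + 3 = N - a + 1 + B" by (simp_all add: N_def B_def)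
    then show ?thesis by (simp only: s2_def Let_def of_int_diff of_int_of_nat_eq of_int_1)
  qed
  have g: "gpoch a (real m - 1 + b + 1) ^ 4 / gpoch (n + (real m - 1) - a + 2) (real m - 1 + b + 1) ^ 4
      = gpoch_quotient a N B ^ 4"
  proof -
    have "real m - 1 + b + 1 = B" "n + (real m - 1) - a + 2 = N - a + 1"
      by (simp_all add: N_def B_def)
    then show ?thesis by (simp only: gpoch_quotient_def power_divide)
  qed
  let ?W = "(- 1 / 4) powi (int m - 1)
      * (gpoch (n - 2 * a + 2) (real m - 1) ^ 5
         / (gpoch (n - 2 * a + 3 / 2) (real m - 1) * gpoch (n - a + 2) (real m - 1) ^ 4))"
  have "s1 a n * rhs_term a b n (int m - 1)
      = s1 a n * ?W * ((q1 a b n (int m - 1) + s2 a b n (int m - 1)) / q2 a n (int m - 1))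
        * (gpoch a (real m - 1 + b + 1) ^ 4 / gpoch (n + (real m - 1) - a + 2) (real m - 1 + b + 1) ^ 4)"
    unfolding rhs_term_def Let_def by (simp add: mult_ac)
  also have "\<dots> = step_product a n m / 2
      * ((q1 a B N (-1) + (- 2 * a + N + 1) ^ 5 * (N + 1 + 2 * B) / (N - a + 1 + B) ^ 4)
         / (4 * a - 2 * N - 1)) * gpoch_quotient a N B ^ 4"
    unfolding q1 q2 s2 g step_product_gpoch[OF assms(1,2)] ..
  also have "\<dots> = step_product a n m * (certificate a N B
      + 2 * s1 a N * (gpoch_quotient a (N + 1) B ^ 4 * (N + 1 + 2 * B)))"
  proof -
    have "- a + N + 1 = N - a + 1" by simp
    then have s1: "s1 a N = (- 2 * a + N + 1) ^ 5 / (4 * (4 * a - 2 * N - 1) * (N - a + 1) ^ 4)"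
      by (simp add: s1_def)
    \<comment> \<open>Stated in free variables: an identity of fractions in which the polynomials are atoms.\<close>
    have gen: "P / 2 * ((q + e * v / X ^ 4) / d) * w ^ 4
        = P * (q / (2 * d) * w ^ 4 + 2 * (e / (4 * d * Y ^ 4)) * ((w * (Y / X)) ^ 4 * v))"
      if "X \<noteq> 0" "Y \<noteq> 0" "d \<noteq> 0" for P q e v X Y d w :: real
      using that by (simp add: field_simps)
    show ?thesis
      unfolding s1 certificate_def gpoch_quotient_shift_n[OF y x] by (rule gen[OF x0 y0 d0])
  qed
  finally show ?thesis by (simp add: N_def B_def)
qed

section \<open>The remainder\<close>

text \<open>
  For large \<open>m\<close> the comparison holds summand by summand. A diagonal step multiplies the quotient of Pochhammer
  symbols by two factors: one is at most $2/3$, the other at most $1$. The linear factor at most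
  doubles, and $2 (2/3)^4 < 1$.
\<close>
lemma f_diagonal_decreasing:
  assumes "a < (2 * n + 1) / 4" "a + b \<notin> \<int>\<^sub>\<le>\<^sub>0" "n - a + 1 + b \<notin> \<int>\<^sub>\<le>\<^sub>0"
    and large: "real m \<ge> 4 + 2 * \<bar>a\<bar> + 2 * \<bar>b\<bar> + \<bar>n\<bar>"
  shows "0 \<le> f a (n + real (Suc m)) (b + real (Suc m))"
    and "f a (n + real (Suc m)) (b + real (Suc m)) \<le> f a (n + real m) (b + real m)"
proof -
  have summ: "summable (f_term a (n + real i) (b + real i))" for i
    using plus_nat_not_nonpos[OF assms(2), of i] plus_nat_not_nonpos[OF assms(3), of "2 * i"] assms(1)
    by (intro f_term_summable) (auto simp: algebra_simps)
  have nonneg: "0 \<le> f_term a (n + real (Suc m)) (b + real (Suc m)) k" for k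
    unfolding f_term_gpoch_quotient using large by (intro mult_nonneg_nonneg) auto
  have le: "f_term a (n + real (Suc m)) (b + real (Suc m)) k \<le> f_term a (n + real m) (b + real m) k" for k
  proof -
    define N B where "N = n + real m" and "B = b + real m + real k"
    have nz: "N - a + 1 \<notin> \<int>\<^sub>\<le>\<^sub>0" "N - a + 1 + B \<notin> \<int>\<^sub>\<le>\<^sub>0" "a + B \<notin> \<int>\<^sub>\<le>\<^sub>0" "N + 1 - a + 1 + B \<notin> \<int>\<^sub>\<le>\<^sub>0"
      using large unfolding N_def B_def by auto
    define u v g where "u = (N - a + 1) / (N - a + 1 + B)" and "v = (a + B) / (N + 1 - a + 1 + B)"
      and "g = gpoch_quotient a N B"
    have pos: "N - a + 1 + B > 0" "N + 1 - a + 1 + B > 0" using large by (auto simp: N_def B_def)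
    have u: "0 \<le> u" "u \<le> 2 / 3" using pos(1) large by (auto simp: u_def divide_simps N_def B_def)
    have v: "0 \<le> v" "v \<le> 1" using pos(2) large by (auto simp: v_def divide_simps N_def B_def)
    have "(u * v) ^ 4 \<le> (2 / 3 * 1) ^ 4" using u v by (intro power_mono mult_mono) auto
    then have uv: "(u * v) ^ 4 \<le> 1 / 2" by (simp add: power_divide)
    have w: "0 \<le> N + 1 + 2 * (B + 1)" "N + 1 + 2 * (B + 1) \<le> 2 * (N + 2 * B)"
      using large by (auto simp: N_def B_def)
    have shift: "gpoch_quotient a (N + 1) (B + 1) = g * u * v"
      using gpoch_quotient_shift_b[OF nz(3,4)] gpoch_quotient_shift_n[OF nz(1,2)] by (simp add: g_def u_def v_def)
    have "f_term a (n + real (Suc m)) (b + real (Suc m)) k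
        = gpoch_quotient a (N + 1) (B + 1) ^ 4 * (N + 1 + 2 * (B + 1))"
      by (simp add: f_term_gpoch_quotient N_def B_def add_ac)
    also have "\<dots> = g ^ 4 * ((u * v) ^ 4 * (N + 1 + 2 * (B + 1)))"
      unfolding shift by (simp add: power_mult_distrib)
    also have "\<dots> \<le> g ^ 4 * (1 / 2 * (2 * (N + 2 * B)))"
      using uv w by (intro mult_left_mono mult_mono) auto
    also have "\<dots> = f_term a (n + real m) (b + real m) k"
      by (simp add: f_term_gpoch_quotient g_def N_def B_def)
    finally show ?thesis .
  qed
  show "0 \<le> f a (n + real (Suc m)) (b + real (Suc m))"
    unfolding f_def by (intro suminf_nonneg summ nonneg)
  show "f a (n + real (Suc m)) (b + real (Suc m)) \<le> f a (n + real m) (b + real m)"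
    unfolding f_def by (intro suminf_le summ le)
qed

text \<open>
  Since $2 s_1(n+m)$ tends to $-1/4$, a step eventually shrinks the remainder by the factor
  $1/2$ at least, and the ratio test applies.
\<close>
lemma remainder_tendsto_0:
  assumes "a < (2 * n + 1) / 4" "a + b \<notin> \<int>\<^sub>\<le>\<^sub>0" "n - a + 1 + b \<notin> \<int>\<^sub>\<le>\<^sub>0"
  shows "remainder a b n \<longlonglongrightarrow> 0"
proof -
  have "(\<lambda>m. 2 * s1 a (n + real m)) \<longlonglongrightarrow> - 1 / 4"
    unfolding s1_def by real_asymp
  then have "(\<lambda>m. norm (2 * s1 a (n + real m))) \<longlonglongrightarrow> norm (- 1 / 4 :: real)"
    by (rule tendsto_norm)
  then have "\<forall>\<^sub>F m in sequentially. norm (2 * s1 a (n + real m)) < 1 / 2"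
    by (rule order_tendstoD) simp
  moreover have "\<forall>\<^sub>F m in sequentially. real m \<ge> 4 + 2 * \<bar>a\<bar> + 2 * \<bar>b\<bar> + \<bar>n\<bar>"
    by real_asymp
  ultimately have "\<forall>\<^sub>F m in sequentially.
      norm (remainder a b n (Suc m)) \<le> 1 / 2 * norm (remainder a b n m)"
  proof eventually_elim
    case (elim m)
    note dec = f_diagonal_decreasing[OF assms elim(2)]
    have "norm (remainder a b n (Suc m)) = norm (2 * s1 a (n + real m))
        * (norm (step_product a n m) * norm (f a (n + real (Suc m)) (b + real (Suc m))))"
      by (simp add: remainder_def step_product_def abs_mult)
    also have "\<dots> \<le> 1 / 2 * (norm (step_product a n m) * norm (f a (n + real m) (b + real m)))"
      using dec elim(1) by (intro mult_mono mult_left_mono) auto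
    finally show ?case by (simp add: remainder_def abs_mult)
  qed
  then obtain M where "\<forall>m\<ge>M. norm (remainder a b n (Suc m)) \<le> 1 / 2 * norm (remainder a b n m)"
    by (auto simp: eventually_sequentially)
  then have "summable (remainder a b n)"
    by (intro summable_ratio_test[of "1 / 2" M]) auto
  then show ?thesis by (rule summable_LIMSEQ_zero)
qed

section \<open>The accelerated series\<close>

theorem theorem2:
  fixes a b n :: real
  assumes "a < (2 * n + 1) / 4"
    and "\<And>k::nat. gpoch_defined a (real k + b)"
    and "\<And>k::nat. gpoch_defined (n - a + 1) (real k + b)"
    and "\<And>j::int. j \<ge> -1 \<Longrightarrow> gpoch_defined (n - 2 * a + 2) (real_of_int j)"
    and "\<And>j::int. j \<ge> -1 \<Longrightarrow> gpoch_defined (n - 2 * a + 3 / 2) (real_of_int j)"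
    and "\<And>j::int. j \<ge> -1 \<Longrightarrow> gpoch_defined (n - a + 2) (real_of_int j)"
    and "\<And>j::int. j \<ge> -1 \<Longrightarrow> gpoch_defined a (real_of_int j + b + 1)"
    and "\<And>j::int. j \<ge> -1 \<Longrightarrow>
           gpoch_defined (n + real_of_int j - a + 2) (real_of_int j + b + 1)"
    and "4 * a - 2 * n - 1 \<noteq> 0"
    and "- a + n + 1 \<noteq> 0"
    and "\<And>j::int. j \<ge> -1 \<Longrightarrow> q2 a n j \<noteq> 0"
    and "\<And>j::int. j \<ge> -1 \<Longrightarrow> - a + b + 2 * real_of_int j + n + 3 \<noteq> 0"
  shows "summable (f_term a n b)
       \<and> summable (\<lambda>i::nat. rhs_term a b n (int i - 1))
       \<and> f a n b = s1 a n * (\<Sum>i::nat. rhs_term a b n (int i - 1))"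
proof -
  have ab: "a + b \<notin> \<int>\<^sub>\<le>\<^sub>0" and na: "n - a + 1 \<notin> \<int>\<^sub>\<le>\<^sub>0" and nab: "n - a + 1 + b \<notin> \<int>\<^sub>\<le>\<^sub>0"
    using assms(2)[of 0] assms(3)[of 0] by (auto simp: gpoch_defined_def)
  \<comment> \<open>The bound on \<open>a\<close> gives \<open>n - 2 * a + 1 > 1 / 2\<close>, so the numerator does not vanish.\<close>
  have s1: "s1 a n \<noteq> 0" using assms(1,9,10) by (simp add: s1_def)
  have summand: "s1 a n * rhs_term a b n (int m - 1) = remainder a b n m - remainder a b n (Suc m)" for m
  proof -
    let ?N = "n + real m" and ?B = "b + real m"
    have nz': "a + ?B \<notin> \<int>\<^sub>\<le>\<^sub>0" "?N - a + 1 \<notin> \<int>\<^sub>\<le>\<^sub>0" "?N - a + 1 + ?B \<notin> \<int>\<^sub>\<le>\<^sub>0" "?N + 1 - a + 1 + ?B \<notin> \<int>\<^sub>\<le>\<^sub>0"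
      using plus_nat_not_nonpos[OF ab, of m] plus_nat_not_nonpos[OF na, of m]
        plus_nat_not_nonpos[OF nab, of "2 * m"] plus_nat_not_nonpos[OF nab, of "2 * m + 1"]
      by (auto simp: algebra_simps)
    have conv: "a < (2 * ?N + 1) / 4" "a < (2 * (?N + 1) + 1) / 4" using assms(1) by auto
    have "f a ?N ?B = certificate a ?N ?B + 2 * s1 a ?N
        * (gpoch_quotient a (?N + 1) ?B ^ 4 * (?N + 1 + 2 * ?B) + f a (?N + 1) (?B + 1))"
      using f_contiguous[OF nz'(1-3) conv(1)]
        f_split_first[OF f_term_summable[OF nz'(1,4) conv(2)]] by simp
    then show ?thesis
      unfolding rhs_term_eq[OF assms(1) na nz'(3)]
      by (simp add: remainder_def step_product_def algebra_simps)
  qed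
  have "(\<lambda>m. s1 a n * rhs_term a b n (int m - 1)) sums f a n b"
    using telescope_sums'[OF remainder_tendsto_0[OF assms(1) ab nab]] unfolding summand
    by (simp add: remainder_def step_product_def)
  then have "(\<lambda>m. rhs_term a b n (int m - 1)) sums (f a n b / s1 a n)"
    using s1 sums_mult_D by fastforce
  then show ?thesis
    using f_term_summable[OF ab nab assms(1)] s1 by (auto simp: sums_iff)
qed

end
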